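(* Let $G$ and $H$ be connected graphs with $G \neq K_1$ and $H$ nonbipartite. Let $G'$ be any connected spanning bipartite subgraph of $G$ and let $H'$ be any connected spanning bipartite subgraph of $H$. Then \[ \pi(G\times H) \le 2\,( \pi(G')+|G|)\, \pi(H')^2. \]
   Context: All graphs are finite, simple, and have at least one vertex; $|G|$ denotes the number of vertices of $G$, and $K_1$ is the one-vertex graph. A configuration on a connected graph $F$ is a placement of pebbles on its vertices (a function $V(F)\to\mathbb{Z}_{\ge 0}$); its size is the total number of pebbles. A pebbling move removes two pebbles from a vertex $u$ carrying at least two pebbles and places one pebble on a vertex adjacent to $u$. Given a root vertex $r$, a configuration is $r$-solvable if, after some finite (possibly empty) sequence of pebbling moves, there is at least one pebble on $r$. The pebbling number $\pi(F)$ is the least number $n$ such that, for every root $r\in V(F)$, every configuration of size $n$ is $r$-solvable. The cross (categorical) product $G \times H$ is the graph with vertex set $V(G)\times V(H)$ in which $(g,h)$ and $(g',h')$ are adjacent exactly when $g,g'$ are adjacent in $G$ and $h,h'$ are adjacent in $H$. *)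

theory Defs
  imports "Graph_Theory.Digraph_Component"
begin

text \<open>
  A finite simple graph is a \<^locale>\<open>pair_graph\<close>: a finite, loop-free, symmetric digraph without
  parallel arcs, so an edge \<open>uv\<close> is the pair of arcs \<open>(u, v)\<close> and \<open>(v, u)\<close>. Note that
  \<^const>\<open>Digraph_Component.connected\<close> includes nonemptiness of the vertex set.
\<close>

definition bipartite :: "'a pair_pre_digraph \<Rightarrow> bool" where
  "bipartite F \<longleftrightarrow> (\<exists>A B. A \<union> B = pverts F \<and> A \<inter> B = {} \<and> parcs F \<subseteq> A \<times> B \<union> B \<times> A)"

definition cross_product ::
    "'a pair_pre_digraph \<Rightarrow> 'b pair_pre_digraph \<Rightarrow> ('a \<times> 'b) pair_pre_digraph" where
  "cross_product G H =
     \<lparr> pverts = pverts G \<times> pverts H,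
       parcs = {((g, h), (g', h')) | g h g' h'. (g, g') \<in> parcs G \<and> (h, h') \<in> parcs H} \<rparr>"

lemma pair_graph_cross_product:
  assumes "pair_graph G" and "pair_graph H"
  shows "pair_graph (cross_product G H)"
proof -
  interpret G: pair_graph G by fact
  interpret H: pair_graph H by fact
  have sub: "parcs (cross_product G H) \<subseteq> (pverts G \<times> pverts H) \<times> (pverts G \<times> pverts H)"
    by (auto simp: cross_product_def dest: G.wellformed' H.wellformed')
  have fin: "finite (pverts G \<times> pverts H)"
    using G.pair_finite_verts H.pair_finite_verts by blast
  show ?thesis
  proof
    show "finite (parcs (cross_product G H))"
      using sub fin by (meson finite_SigmaI finite_subset)
    show "symmetric (with_proj (cross_product G H))"
      by (auto simp: symmetric_def cross_product_def
          intro!: symI dest: G.arcs_symmetric H.arcs_symmetric)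
  qed (use fin in \<open>auto simp: cross_product_def dest: G.wellformed' H.wellformed' G.no_loops'\<close>)
qed

text \<open>Configurations are extended by \<open>0\<close> outside the vertex set.\<close>

definition configuration :: "'a pair_pre_digraph \<Rightarrow> ('a \<Rightarrow> nat) \<Rightarrow> bool" where
  "configuration F c \<longleftrightarrow> (\<forall>v. v \<notin> pverts F \<longrightarrow> c v = 0)"

definition config_size :: "'a pair_pre_digraph \<Rightarrow> ('a \<Rightarrow> nat) \<Rightarrow> nat" where
  "config_size F c = (\<Sum>v\<in>pverts F. c v)"

definition pebbling_move :: "'a pair_pre_digraph \<Rightarrow> ('a \<Rightarrow> nat) \<Rightarrow> ('a \<Rightarrow> nat) \<Rightarrow> bool" where
  "pebbling_move F c d \<longleftrightarrow>
     (\<exists>u v. (u, v) \<in> parcs F \<and> 2 \<le> c u \<and> d = c(u := c u - 2, v := c v + 1))"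

definition solvable :: "'a pair_pre_digraph \<Rightarrow> 'a \<Rightarrow> ('a \<Rightarrow> nat) \<Rightarrow> bool" where
  "solvable F r c \<longleftrightarrow> (\<exists>d. (pebbling_move F)\<^sup>*\<^sup>* c d \<and> 1 \<le> d r)"

text \<open>A number as required below exists whenever \<open>F\<close> is a finite connected graph; otherwise the value
  need not be meaningful.\<close>

definition pebbling_number :: "'a pair_pre_digraph \<Rightarrow> nat" where
  "pebbling_number F =
     (LEAST n. \<forall>r\<in>pverts F. \<forall>c. configuration F c \<and> config_size F c = n \<longrightarrow> solvable F r c)"

end

theory Submission
  imports Defs
begin

text \<open>
  Write \<open>p = \<pi>(G')\<close>, \<open>q = \<pi>(H')\<close> and \<open>n = |G|\<close>, and 2-colour \<open>G'\<close> and \<open>H'\<close> so that the two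
  coordinates of the root \<open>(r, h)\<close> have equal colours. Call a vertex of \<open>G \<times> H\<close> even if its coordinates
  have equal colours, and odd otherwise; \<open>G' \<times> H'\<close> has no arcs between even and odd vertices.

  The product contains many homomorphic images of the factors. For an arc \<open>(g, g')\<close> of \<open>G'\<close>, sending the
  vertices of \<open>H'\<close> of one colour into the fibre over \<open>g\<close> and those of the other colour into the fibre over
  \<open>g'\<close> is a homomorphism from \<open>H'\<close>; so \<open>m\<close> pebbles on one colour class of the fibre over \<open>g\<close> can be
  gathered into \<open>m div q\<close> pebbles on any vertex of this image (\<open>gather_half_fibre\<close>). In the same
  way an arc of \<open>H'\<close> at \<open>h\<close> gives an image of \<open>G'\<close> that consists of even vertices. Hence \<open>p q + n (q - 1)\<close>
  pebbles on even vertices are enough: gather within each of the \<open>n\<close> fibres, losing at most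
  \<open>q - 1\<close> pebbles per fibre to rounding, so that at least \<open>p\<close> pebbles arrive on the image of \<open>G'\<close>, and
  solve there (\<open>solve_even_component\<close>).

  As \<open>H\<close> is not bipartite, it has an arc \<open>(h1, h2)\<close> between vertices of equal colour, and an arc of
  \<open>G'\<close> combined with it leads from odd to even vertices. Gathering the odd pebbles of a fibre over \<open>h1\<close>
  and moving them across turns \<open>w\<close> of them into \<open>w div (2 q)\<close> even pebbles
  (\<open>cross_to_even_component\<close>). Starting from \<open>2 (p + n) q\<^sup>2\<close> pebbles, at least
  \<open>(p + n) q - n = p q + n (q - 1)\<close> even pebbles result, whatever the initial distribution
  (\<open>solve_with_odd_edge\<close>).
\<close>

section \<open>Pebbling up to discarded pebbles\<close>

definition pile :: "nat \<Rightarrow> 'a \<Rightarrow> 'a \<Rightarrow> nat" where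
  "pile k x = (\<lambda>y. if y = x then k else 0)"

definition part :: "('a \<Rightarrow> nat) \<Rightarrow> 'a set \<Rightarrow> 'a \<Rightarrow> nat" where
  "part c S = (\<lambda>y. if y \<in> S then c y else 0)"

text \<open>
  Allowing pebbles to be thrown away makes the relation monotone, additive and transitive, so that
  partial strategies compose without tracking the pebbles that they leave behind.
\<close>

definition yields :: "'a pair_pre_digraph \<Rightarrow> ('a \<Rightarrow> nat) \<Rightarrow> ('a \<Rightarrow> nat) \<Rightarrow> bool" where
  "yields F c d \<longleftrightarrow> (\<exists>d'. (pebbling_move F)\<^sup>*\<^sup>* c d' \<and> d \<le> d')"

lemma pebbling_move_add:
  assumes "pebbling_move F c d"
  shows "pebbling_move F (\<lambda>x. c x + e x) (\<lambda>x. d x + e x)"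
proof -
  obtain u v where "(u, v) \<in> parcs F" "2 \<le> c u" "d = c(u := c u - 2, v := c v + 1)"
    using assms by (auto simp: pebbling_move_def)
  then show ?thesis
    unfolding pebbling_move_def by (intro exI[of _ u] exI[of _ v]) (auto simp: fun_eq_iff)
qed

lemma pebbling_moves_add:
  assumes "(pebbling_move F)\<^sup>*\<^sup>* c d"
  shows "(pebbling_move F)\<^sup>*\<^sup>* (\<lambda>x. c x + e x) (\<lambda>x. d x + e x)"
  using assms
proof (induction rule: rtranclp_induct)
  case (step y z)
  show ?case
    using step.IH pebbling_move_add[OF step.hyps(2), of e]
      rtranclp.rtrancl_into_rtrancl[of "pebbling_move F" "\<lambda>x. c x + e x" "\<lambda>x. y x + e x"]
    by blast
qed simp

lemma yields_refl: "d \<le> c \<Longrightarrow> yields F c d"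
  unfolding yields_def by blast

lemma pebbling_moves_mono:
  assumes "(pebbling_move F)\<^sup>*\<^sup>* c d" and "c \<le> c'"
  shows "\<exists>d'. (pebbling_move F)\<^sup>*\<^sup>* c' d' \<and> d \<le> d'"
proof -
  have "(\<lambda>x. c x + (c' x - c x)) = c'"
    using assms(2) by (auto simp: le_fun_def fun_eq_iff)
  with pebbling_moves_add[OF assms(1), of "\<lambda>x. c' x - c x"]
  show ?thesis by (intro exI[of _ "\<lambda>x. d x + (c' x - c x)"]) (auto simp: le_fun_def)
qed

lemma yields_mono:
  assumes "yields F c d" and "c \<le> c'" and "d' \<le> d"
  shows "yields F c' d'"
  using assms pebbling_moves_mono unfolding yields_def by (meson order_trans)

lemma yields_trans:
  assumes "yields F c d" and "yields F d e"
  shows "yields F c e"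
proof -
  obtain d' where d': "(pebbling_move F)\<^sup>*\<^sup>* c d'" "d \<le> d'"
    using assms(1) by (auto simp: yields_def)
  have "yields F d' e" using assms(2) d'(2) by (rule yields_mono) simp
  then show ?thesis using d'(1) by (auto simp: yields_def intro: rtranclp_trans)
qed

lemma yields_add_right:
  assumes "yields F c d"
  shows "yields F (\<lambda>x. c x + e x) (\<lambda>x. d x + e x)"
  using assms pebbling_moves_add[of F c _ e] unfolding yields_def
  by (fastforce simp: le_fun_def)

lemma yields_add:
  assumes "yields F c d" and "yields F c' d'"
  shows "yields F (\<lambda>x. c x + c' x) (\<lambda>x. d x + d' x)"
  using yields_trans[OF yields_add_right[OF assms(1), of c']]
    yields_add_right[OF assms(2), of d] by (simp add: add.commute)

lemma yields_sum:
  assumes "finite I" and "\<And>i. i \<in> I \<Longrightarrow> yields F (c i) (d i)"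
  shows "yields F (\<lambda>x. \<Sum>i\<in>I. c i x) (\<lambda>x. \<Sum>i\<in>I. d i x)"
  using assms by (induction I rule: finite_induct) (auto intro: yields_refl yields_add)

lemma solvable_iff_yields: "solvable F r c \<longleftrightarrow> yields F c (pile 1 r)"
  unfolding solvable_def yields_def pile_def by (force simp: le_fun_def)

lemma pile_add: "pile (k + l) x = (\<lambda>y. pile k x y + pile l x y)"
  by (auto simp: pile_def)

lemma yields_across_arc:
  assumes "(u, v) \<in> parcs F"
  shows "yields F (pile (2 * k) u) (pile k v)"
proof (induction k)
  case 0
  then show ?case by (auto intro: yields_refl simp: pile_def)
next
  case (Suc k)
  have "pebbling_move F (pile 2 u) ((pile 2 u)(u := pile 2 u u - 2, v := pile 2 u v + 1))"
    unfolding pebbling_move_def using assms by (intro exI[of _ u] exI[of _ v]) (auto simp: pile_def)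
  then have "yields F (pile 2 u) (pile 1 v)"
    unfolding yields_def
    by (intro exI[of _ "(pile 2 u)(u := pile 2 u u - 2, v := pile 2 u v + 1)"])
      (auto simp: le_fun_def pile_def)
  then have "yields F (\<lambda>y. pile 2 u y + pile (2 * k) u y) (\<lambda>y. pile 1 v y + pile k v y)"
    using Suc.IH by (rule yields_add)
  then show ?case by (simp flip: pile_add)
qed

section \<open>Solving in a connected graph\<close>

lemma connected_imp_rtrancl:
  assumes "pair_graph F" and "Digraph_Component.connected (with_proj F)"
    and "u \<in> pverts F" and "v \<in> pverts F"
  shows "(u, v) \<in> (parcs F)\<^sup>*"
proof -
  interpret pair_graph F by fact
  have "strongly_connected (with_proj F)"
    using assms(2) by (rule symmetric_connected_imp_strongly_connected[OF sym_arcs])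
  then have "u \<rightarrow>\<^sup>*\<^bsub>with_proj F\<^esub> v" using assms(3,4) by (auto simp: strongly_connected_def)
  then show ?thesis by (auto dest: reachable_rtranclI simp: arcs_ends_def arc_to_ends_def)
qed

lemma rtrancl_imp_pile_yields:
  assumes "(v, r) \<in> (parcs F)\<^sup>*"
  shows "\<exists>k. yields F (pile k v) (pile 1 r)"
  using assms
proof (induction rule: converse_rtrancl_induct)
  case base
  then show ?case by (auto intro: yields_refl)
next
  case (step u v)
  then show ?case by (meson yields_across_arc yields_trans)
qed

text \<open>
  The defining set of the pebbling number is inhabited: for each pair \<open>(r, v)\<close> some number of pebbles
  on \<open>v\<close> is enough to reach \<open>r\<close>, and by the pigeonhole principle a configuration whose size is the
  sum of all these numbers has enough pebbles on one vertex.
\<close>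

lemma pebbling_number_solvable:
  assumes "pair_graph F" and "Digraph_Component.connected (with_proj F)"
    and "r \<in> pverts F" and "configuration F c" and "config_size F c = pebbling_number F"
  shows "solvable F r c"
proof -
  interpret pair_graph F by fact
  have fin: "finite (pverts F)" by simp
  have "\<forall>r\<in>pverts F. \<forall>v\<in>pverts F. \<exists>k. yields F (pile k v) (pile 1 r)"
    using connected_imp_rtrancl[OF assms(1,2)] rtrancl_imp_pile_yields by metis
  then obtain k where k: "\<And>r v. r \<in> pverts F \<Longrightarrow> v \<in> pverts F \<Longrightarrow> yields F (pile (k r v) v) (pile 1 r)"
    by metis
  define N where "N = (\<Sum>v\<in>pverts F. \<Sum>r\<in>pverts F. k r v)"
  have "\<forall>r\<in>pverts F. \<forall>c. configuration F c \<and> config_size F c = N \<longrightarrow> solvable F r c"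
  proof (intro ballI allI impI)
    fix r c assume r: "r \<in> pverts F" and c: "configuration F c \<and> config_size F c = N"
    have "\<exists>v\<in>pverts F. k r v \<le> c v"
    proof (rule ccontr)
      assume "\<not> ?thesis"
      then have "config_size F c < (\<Sum>v\<in>pverts F. k r v)"
        unfolding config_size_def using fin r by (intro sum_strict_mono) auto
      also have "\<dots> \<le> N" unfolding N_def
        using fin r by (intro sum_mono member_le_sum) auto
      finally show False using c by simp
    qed
    then obtain v where v: "v \<in> pverts F" "k r v \<le> c v" by blast
    then have "yields F c (pile 1 r)"
      using k[OF r v(1)] by (rule_tac yields_mono) (auto simp: le_fun_def pile_def)
    then show "solvable F r c" by (simp add: solvable_iff_yields)
  qed
  from LeastI[of "\<lambda>n. \<forall>r\<in>pverts F. \<forall>c. configuration F c \<and> config_size F c = n \<longrightarrow> solvable F r c", OF this]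
  show ?thesis using assms(3-5) unfolding pebbling_number_def by blast
qed

lemma exists_subconfiguration:
  assumes "finite (pverts F)" and "a \<le> (\<Sum>x\<in>pverts F. w x)"
  shows "\<exists>u\<le>w. configuration F u \<and> config_size F u = a"
  using assms(2)
proof (induction a)
  case 0
  then show ?case
    by (intro exI[of _ "\<lambda>_. 0"]) (auto simp: configuration_def config_size_def le_fun_def)
next
  case (Suc a)
  then obtain u where u: "u \<le> w" "configuration F u" "config_size F u = a" by auto
  have "\<exists>x\<in>pverts F. u x < w x"
  proof (rule ccontr)
    assume "\<not> ?thesis"
    then have "(\<Sum>x\<in>pverts F. w x) \<le> config_size F u"
      unfolding config_size_def by (intro sum_mono) auto
    then show False using u(3) Suc.prems by simp
  qed
  then obtain x where x: "x \<in> pverts F" "u x < w x" by blast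
  have "config_size F (u(x := u x + 1)) = Suc a"
    using u(3) assms(1) x(1) unfolding config_size_def
    by (simp add: sum.remove[of "pverts F" x])
  moreover have "u(x := u x + 1) \<le> w" using u(1) x(2) by (auto simp: le_fun_def)
  moreover have "configuration F (u(x := u x + 1))"
    using u(2) x(1) by (auto simp: configuration_def)
  ultimately show ?case by blast
qed

text \<open>
  Disjoint sets of pebbles can be moved independently, so \<open>k\<close> groups of \<open>\<pi>(F)\<close> pebbles bring
  \<open>k\<close> pebbles to the root.
\<close>

lemma yields_many_at_root:
  assumes F: "pair_graph F" "Digraph_Component.connected (with_proj F)" and r: "r \<in> pverts F"
    and "k * pebbling_number F \<le> (\<Sum>x\<in>pverts F. w x)"
  shows "yields F w (pile k r)"
  using assms(4)
proof (induction k arbitrary: w)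
  case 0
  then show ?case by (auto intro: yields_refl simp: pile_def le_fun_def)
next
  case (Suc k)
  interpret pair_graph F by (rule F(1))
  have fin: "finite (pverts F)" by simp
  obtain u where u: "u \<le> w" "configuration F u" "config_size F u = pebbling_number F"
    using exists_subconfiguration[OF fin, of "pebbling_number F" w] Suc.prems by auto
  have "(\<Sum>x\<in>pverts F. w x - u x) = (\<Sum>x\<in>pverts F. w x) - (\<Sum>x\<in>pverts F. u x)"
    using u(1) by (intro sum_subtractf_nat) (auto simp: le_fun_def)
  then have "yields F (\<lambda>x. w x - u x) (pile k r)"
    using Suc u(3) by (intro Suc.IH) (auto simp: config_size_def)
  moreover have "yields F u (pile 1 r)"
    using pebbling_number_solvable[OF F r u(2,3)] by (simp add: solvable_iff_yields)
  ultimately have "yields F (\<lambda>x. u x + (w x - u x)) (\<lambda>x. pile 1 r x + pile k r x)"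
    by (intro yields_add)
  moreover have "(\<lambda>x. u x + (w x - u x)) = w" using u(1) by (auto simp: le_fun_def fun_eq_iff)
  ultimately show ?case by (simp flip: pile_add)
qed

text \<open>The empty configuration solves nothing.\<close>

lemma pebbling_number_pos:
  assumes "pair_graph F" and "Digraph_Component.connected (with_proj F)"
  shows "0 < pebbling_number F"
proof (rule ccontr)
  assume "\<not> ?thesis"
  then have z: "pebbling_number F = 0" by simp
  obtain r where r: "r \<in> pverts F"
    using assms(2) by (auto simp: connected_def strongly_connected_def)
  have "solvable F r (\<lambda>_. 0)"
    using z by (intro pebbling_number_solvable[OF assms r])
      (auto simp: configuration_def config_size_def)
  then obtain d where d: "(pebbling_move F)\<^sup>*\<^sup>* (\<lambda>_. 0) d" "1 \<le> d r"
    by (auto simp: solvable_def)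
  from d(1) have "d = (\<lambda>_. 0)"
    by (induction rule: rtranclp_induct) (auto simp: pebbling_move_def)
  with d(2) show False by simp
qed

section \<open>Images of configurations under graph homomorphisms\<close>

text \<open>The image of \<open>w\<close> under \<open>f\<close>: pebbles on vertices identified by \<open>f\<close> are put together.\<close>

definition push :: "'a set \<Rightarrow> ('a \<Rightarrow> 'b) \<Rightarrow> ('a \<Rightarrow> nat) \<Rightarrow> 'b \<Rightarrow> nat" where
  "push V f w = (\<lambda>y. \<Sum>x\<in>V. pile (w x) (f x) y)"

lemma push_add: "push V f (\<lambda>x. c x + d x) = (\<lambda>y. push V f c y + push V f d y)"
  by (simp add: push_def pile_add sum.distrib)

lemma push_pile: "finite V \<Longrightarrow> x \<in> V \<Longrightarrow> push V f (pile k x) = pile k (f x)"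
proof (rule ext)
  fix y assume V: "finite V" "x \<in> V"
  have "push V f (pile k x) y = (\<Sum>z\<in>V. if z = x then pile k (f x) y else 0)"
    unfolding push_def by (intro sum.cong) (auto simp: pile_def)
  then show "push V f (pile k x) y = pile k (f x) y" using V by simp
qed

lemma push_mono: "c \<le> d \<Longrightarrow> push V f c \<le> push V f d"
  unfolding push_def le_fun_def by (auto intro!: sum_mono simp: pile_def)

text \<open>
  A homomorphism maps each move to a move, and identifying vertices only brings pebbles together.
\<close>

lemma yields_push:
  assumes "pair_graph F" and hom: "\<And>x y. (x, y) \<in> parcs F \<Longrightarrow> (f x, f y) \<in> parcs K"
    and "yields F c d"
  shows "yields K (push (pverts F) f c) (push (pverts F) f d)"
proof -
  interpret pair_graph F by fact
  have fin: "finite (pverts F)" by simp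
  let ?p = "push (pverts F) f"
  have move: "yields K (?p c) (?p d)" if m: "pebbling_move F c d" for c d
  proof -
    obtain u v where uv: "(u, v) \<in> parcs F" "2 \<le> c u" "d = c(u := c u - 2, v := c v + 1)"
      using m unfolding pebbling_move_def by blast
    then have V: "u \<in> pverts F" "v \<in> pverts F" by (auto dest: wellformed')
    have "u \<noteq> v" using uv(1) no_loops' by blast
    \<comment> \<open>Without a loop at \<open>u\<close> the move is a replacement of \<open>pile 2 u\<close> by \<open>pile 1 v\<close> inside \<open>c\<close>.\<close>
    define e where "e = c(u := c u - 2)"
    have c: "c = (\<lambda>x. pile 2 u x + e x)" using uv(2) by (auto simp: e_def pile_def fun_eq_iff)
    have d: "d = (\<lambda>x. pile 1 v x + e x)"
      using uv(3) \<open>u \<noteq> v\<close> by (auto simp: e_def pile_def fun_eq_iff)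
    have "yields K (pile 2 (f u)) (pile 1 (f v))"
      using yields_across_arc[OF hom[OF uv(1)], of 1] by simp
    then show ?thesis unfolding c d push_add
      by (simp only: push_pile[OF fin V(1)] push_pile[OF fin V(2)]) (rule yields_add_right)
  qed
  obtain d' where d': "(pebbling_move F)\<^sup>*\<^sup>* c d'" "d \<le> d'"
    using assms(3) by (auto simp: yields_def)
  from d'(1) have "yields K (?p c) (?p d')"
    by (induction rule: rtranclp_induct) (auto intro: yields_refl dest: move yields_trans)
  then show ?thesis using push_mono[OF d'(2)] by (rule_tac yields_mono) auto
qed

lemma yields_in_image:
  assumes "pair_graph F" and "Digraph_Component.connected (with_proj F)"
    and "\<And>x y. (x, y) \<in> parcs F \<Longrightarrow> (f x, f y) \<in> parcs K"
    and "r \<in> pverts F" and "k * pebbling_number F \<le> (\<Sum>x\<in>pverts F. w x)"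
  shows "yields K (push (pverts F) f w) (pile k (f r))"
proof -
  interpret pair_graph F by fact
  have "yields F w (pile k r)" using assms by (intro yields_many_at_root) auto
  from yields_push[where f = f, OF assms(1,3) this] show ?thesis
    using assms(4) by (simp add: push_pile)
qed

section \<open>Two bipartite factors\<close>

text \<open>
  Here \<open>A\<close> and \<open>B\<close> stand for the bipartite spanning subgraphs and \<open>K\<close> for the product of the whole
  graphs, of which only the arcs inherited from \<open>A\<close> and \<open>B\<close> are known.
\<close>

locale bicoloured_factors =
  fixes A :: "'a pair_pre_digraph" and B :: "'b pair_pre_digraph"
    and K :: "('a \<times> 'b) pair_pre_digraph" and \<alpha> :: "'a \<Rightarrow> bool" and \<beta> :: "'b \<Rightarrow> bool"
  assumes A: "pair_graph A" "Digraph_Component.connected (with_proj A)"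
    and B: "pair_graph B" "Digraph_Component.connected (with_proj B)"
    and cross: "(g, g') \<in> parcs A \<Longrightarrow> (h, h') \<in> parcs B \<Longrightarrow> ((g, h), (g', h')) \<in> parcs K"
    and \<alpha>: "(g, g') \<in> parcs A \<Longrightarrow> \<alpha> g \<noteq> \<alpha> g'"
    and \<beta>: "(h, h') \<in> parcs B \<Longrightarrow> \<beta> h \<noteq> \<beta> h'"
begin

definition half_fibre :: "'a \<Rightarrow> bool \<Rightarrow> ('a \<times> 'b) set" where
  "half_fibre g b = {g} \<times> {h \<in> pverts B. \<beta> h = b}"

lemma sum_fibre: "sum c ({g} \<times> X) = (\<Sum>h\<in>X. c (g, h))"
  by (rule sum.reindex_bij_witness[of _ "Pair g" snd]) auto

lemma finite_half_fibre: "finite (half_fibre g b)"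
proof -
  interpret pair_graph B by (rule B(1))
  show ?thesis by (simp add: half_fibre_def)
qed

text \<open>
  The map \<open>h \<mapsto> (g, h)\<close> for \<open>h\<close> of colour \<open>b\<close> and \<open>h \<mapsto> (g', h)\<close> otherwise is a homomorphism from \<open>B\<close>,
  because each arc of \<open>B\<close> changes the colour and so is paired with \<open>(g, g')\<close> or \<open>(g', g)\<close>. Its image
  contains the half fibre, so solving in \<open>B\<close> gathers the pebbles.
\<close>

lemma gather_half_fibre:
  assumes gg': "(g, g') \<in> parcs A" and h: "h \<in> pverts B"
  shows "yields K (part c (half_fibre g b))
    (pile (sum c (half_fibre g b) div pebbling_number B) (if \<beta> h = b then g else g', h))"
proof -
  interpret pair_graph B by (rule B(1))
  interpret A: pair_graph A by (rule A(1))
  define f where "f = (\<lambda>h. (if \<beta> h = b then g else g', h))"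
  define w where "w = (\<lambda>h. if \<beta> h = b then c (g, h) else 0)"
  have g'g: "(g', g) \<in> parcs A" using gg' by (rule A.arcs_symmetric)
  have hom: "(f x, f y) \<in> parcs K" if "(x, y) \<in> parcs B" for x y
    using that \<beta>[OF that] cross[OF gg' that] cross[OF g'g that] by (auto simp: f_def)
  have "sum c (half_fibre g b) = (\<Sum>h\<in>{h \<in> pverts B. \<beta> h = b}. c (g, h))"
    unfolding half_fibre_def by (rule sum_fibre)
  also have "\<dots> = (\<Sum>h\<in>pverts B. w h)"
    unfolding w_def by (simp add: sum.inter_filter)
  finally have "sum c (half_fibre g b) = (\<Sum>h\<in>pverts B. w h)" .
  then have "yields K (push (pverts B) f w)
      (pile (sum c (half_fibre g b) div pebbling_number B) (f h))"
    by (intro yields_in_image[OF B hom h]) auto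
  moreover have "push (pverts B) f w = part c (half_fibre g b)"
  proof (rule ext)
    fix y :: "'a \<times> 'b"
    obtain y1 y2 where y: "y = (y1, y2)" by fastforce
    have "push (pverts B) f w y
        = (\<Sum>x\<in>pverts B. if x = y2 then (if \<beta> x = b \<and> y1 = g then c y else 0) else 0)"
      unfolding push_def by (intro sum.cong) (auto simp: pile_def f_def w_def y)
    then show "push (pverts B) f w y = part c (half_fibre g b) y"
      by (auto simp: part_def half_fibre_def y)
  qed
  ultimately show ?thesis by (simp add: f_def)
qed

text \<open>
  The even vertices over \<open>g\<close> form the half fibre of colour \<open>\<alpha> g\<close>. The gathering point over \<open>g\<close> is
  whichever of \<open>(g, h)\<close> and \<open>(g, h')\<close> is even; these points form an image of \<open>A\<close> through \<open>(r, h)\<close>.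
\<close>

lemma solve_even_component:
  assumes nb: "\<And>g. g \<in> pverts A \<Longrightarrow> \<exists>g'. (g, g') \<in> parcs A"
    and hh': "(h, h') \<in> parcs B" and r: "r \<in> pverts A" and rh: "\<alpha> r = \<beta> h"
    and size: "pebbling_number A * pebbling_number B + card (pverts A) * (pebbling_number B - 1)
      \<le> (\<Sum>g\<in>pverts A. sum c (half_fibre g (\<alpha> g)))"
  shows "yields K c (pile 1 (r, h))"
proof -
  interpret pair_graph B by (rule B(1))
  interpret A: pair_graph A by (rule A(1))
  let ?q = "pebbling_number B"
  have q: "0 < ?q" using B by (rule pebbling_number_pos)
  define t where "t g = (if \<alpha> g = \<beta> h then h else h')" for g
  define m where "m g = sum c (half_fibre g (\<alpha> g))" for g
  have t: "t g \<in> pverts B" "\<beta> (t g) = \<alpha> g" for g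
    using hh' \<beta>[OF hh'] by (auto simp: t_def dest: wellformed')
  have "yields K (part c (half_fibre g (\<alpha> g))) (pile (m g div ?q) (g, t g))"
    if g: "g \<in> pverts A" for g
  proof -
    obtain g' where "(g, g') \<in> parcs A" using nb[OF g] by blast
    from gather_half_fibre[OF this t(1), of c "\<alpha> g" g] show ?thesis by (simp add: m_def t)
  qed
  then have "yields K (\<lambda>y. \<Sum>g\<in>pverts A. part c (half_fibre g (\<alpha> g)) y)
      (push (pverts A) (\<lambda>g. (g, t g)) (\<lambda>g. m g div ?q))"
    unfolding push_def by (intro yields_sum) auto
  moreover have "(\<lambda>y. \<Sum>g\<in>pverts A. part c (half_fibre g (\<alpha> g)) y) \<le> c"
  proof (rule le_funI)
    fix y :: "'a \<times> 'b"
    have "(\<Sum>g\<in>pverts A. part c (half_fibre g (\<alpha> g)) y)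
        \<le> (\<Sum>g\<in>pverts A. if g = fst y then c y else 0)"
      by (intro sum_mono) (auto simp: part_def half_fibre_def)
    also have "\<dots> \<le> c y" by simp
    finally show "(\<Sum>g\<in>pverts A. part c (half_fibre g (\<alpha> g)) y) \<le> c y" .
  qed
  ultimately have 1: "yields K c (push (pverts A) (\<lambda>g. (g, t g)) (\<lambda>g. m g div ?q))"
    by (rule yields_mono) simp
  have "pebbling_number A \<le> (\<Sum>g\<in>pverts A. m g div ?q)"
  proof -
    have "m g \<le> ?q * (m g div ?q) + (?q - 1)" for g
      using mult_div_mod_eq[of ?q "m g"] mod_less_divisor[OF q, of "m g"] by linarith
    then have "(\<Sum>g\<in>pverts A. m g) \<le> (\<Sum>g\<in>pverts A. ?q * (m g div ?q) + (?q - 1))"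
      by (intro sum_mono)
    also have "\<dots> = ?q * (\<Sum>g\<in>pverts A. m g div ?q) + card (pverts A) * (?q - 1)"
      by (simp add: sum.distrib sum_distrib_left)
    finally have "?q * pebbling_number A \<le> ?q * (\<Sum>g\<in>pverts A. m g div ?q)"
      using size mult.commute[of "pebbling_number A" ?q] unfolding m_def by linarith
    then show ?thesis using q by simp
  qed
  moreover have "((g, t g), (g', t g')) \<in> parcs K" if "(g, g') \<in> parcs A" for g g'
    using \<alpha>[OF that] cross[OF that hh'] cross[OF that arcs_symmetric[OF hh']]
    by (auto simp: t_def)
  ultimately have "yields K (push (pverts A) (\<lambda>g. (g, t g)) (\<lambda>g. m g div ?q)) (pile 1 (r, t r))"
    by (intro yields_in_image[OF A _ r]) auto
  with 1 have "yields K c (pile 1 (r, t r))" by (rule yields_trans)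
  then show ?thesis using rh by (simp add: t_def)
qed

text \<open>
  The odd pebbles over \<open>g\<close> are gathered on the odd vertex \<open>(x, h1)\<close>, where \<open>x\<close> is \<open>g\<close> or its neighbour.
  The arc to \<open>(x', h2)\<close> changes the colour of the first coordinate but not of the second, so it ends
  in an even vertex; moving along it costs the factor \<open>2\<close>.
\<close>

lemma cross_to_even_component:
  assumes nb: "\<And>g. g \<in> pverts A \<Longrightarrow> \<exists>g'. (g, g') \<in> parcs A"
    and h1: "h1 \<in> pverts B" and h12: "\<beta> h1 = \<beta> h2"
    and odd: "\<And>x x'. (x, x') \<in> parcs A \<Longrightarrow> ((x, h1), (x', h2)) \<in> parcs K"
    and g: "g \<in> pverts A"
  shows "\<exists>x\<in>pverts A. \<alpha> x = \<beta> h2 \<and> yields K (part c (half_fibre g (\<not> \<alpha> g)))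
    (pile (sum c (half_fibre g (\<not> \<alpha> g)) div (2 * pebbling_number B)) (x, h2))"
proof -
  interpret A: pair_graph A by (rule A(1))
  obtain g' where gg': "(g, g') \<in> parcs A" using nb[OF g] by blast
  let ?m = "sum c (half_fibre g (\<not> \<alpha> g)) div pebbling_number B"
  obtain x x' where x: "x = (if \<beta> h1 = (\<not> \<alpha> g) then g else g')" "(x, x') \<in> parcs A"
    using gg' A.arcs_symmetric[OF gg'] by (cases "\<beta> h1 = (\<not> \<alpha> g)") auto
  have "yields K (part c (half_fibre g (\<not> \<alpha> g))) (pile ?m (x, h1))"
    using gather_half_fibre[OF gg' h1, of c "\<not> \<alpha> g"] x(1) by simp
  moreover have "yields K (pile ?m (x, h1)) (pile (2 * (?m div 2)) (x, h1))"
    by (rule yields_refl) (auto simp: pile_def le_fun_def)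
  moreover have "yields K (pile (2 * (?m div 2)) (x, h1)) (pile (?m div 2) (x', h2))"
    using odd[OF x(2)] by (rule yields_across_arc)
  ultimately have "yields K (part c (half_fibre g (\<not> \<alpha> g))) (pile (?m div 2) (x', h2))"
    by (meson yields_trans)
  moreover have "\<alpha> x' = \<beta> h2"
    using \<alpha>[OF x(2)] \<alpha>[OF gg'] x(1) h12 by (auto split: if_splits)
  moreover have "x' \<in> pverts A" using x(2) by (auto dest: A.wellformed')
  ultimately show ?thesis by (auto simp: div_mult2_eq[symmetric] mult.commute)
qed

text \<open>
  Even pebbles stay in place while the odd ones cross over. The first count \<open>?E c\<close> enters the estimate
  with coefficient \<open>1 \<le> 2 q\<close>, so the least favourable case is that all pebbles start on odd vertices.
\<close>

lemma solve_with_odd_edge: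
  assumes nb: "\<And>g. g \<in> pverts A \<Longrightarrow> \<exists>g'. (g, g') \<in> parcs A"
    and hh': "(h, h') \<in> parcs B" and r: "r \<in> pverts A" and rh: "\<alpha> r = \<beta> h"
    and h1: "h1 \<in> pverts B" and h2: "h2 \<in> pverts B" and h12: "\<beta> h1 = \<beta> h2"
    and odd: "\<And>x x'. (x, x') \<in> parcs A \<Longrightarrow> ((x, h1), (x', h2)) \<in> parcs K"
    and size: "2 * (pebbling_number A + card (pverts A)) * (pebbling_number B)\<^sup>2
      \<le> (\<Sum>v\<in>pverts A \<times> pverts B. c v)"
  shows "yields K c (pile 1 (r, h))"
proof -
  interpret pair_graph B by (rule B(1))
  interpret A: pair_graph A by (rule A(1))
  let ?p = "pebbling_number A" and ?q = "pebbling_number B" and ?n = "card (pverts A)"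
  let ?E = "\<lambda>c. \<Sum>g\<in>pverts A. sum c (half_fibre g (\<alpha> g))"
  define w where "w g = sum c (half_fibre g (\<not> \<alpha> g))" for g
  define S where "S = (\<Union>g\<in>pverts A. half_fibre g (\<alpha> g))"
  have q: "0 < ?q" using B by (rule pebbling_number_pos)
  obtain x where x: "\<And>g. g \<in> pverts A \<Longrightarrow> x g \<in> pverts A \<and> \<alpha> (x g) = \<beta> h2 \<and>
      yields K (part c (half_fibre g (\<not> \<alpha> g))) (pile (w g div (2 * ?q)) (x g, h2))"
    using cross_to_even_component[OF nb h1 h12 odd, of _ c] unfolding w_def by metis
  define c' where "c' y = part c S y + (\<Sum>g\<in>pverts A. pile (w g div (2 * ?q)) (x g, h2) y)" for y
  have "yields K (\<lambda>y. part c S y + (\<Sum>g\<in>pverts A. part c (half_fibre g (\<not> \<alpha> g)) y)) c'"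
    unfolding c'_def by (intro yields_add[OF yields_refl] yields_sum) (use x in auto)
  moreover have "(\<lambda>y. part c S y + (\<Sum>g\<in>pverts A. part c (half_fibre g (\<not> \<alpha> g)) y)) \<le> c"
  proof (rule le_funI)
    fix y :: "'a \<times> 'b"
    have "(\<Sum>g\<in>pverts A. part c (half_fibre g (\<not> \<alpha> g)) y)
        \<le> (\<Sum>g\<in>pverts A. if g = fst y then (if \<beta> (snd y) \<noteq> \<alpha> (fst y) then c y else 0) else 0)"
      by (intro sum_mono) (auto simp: part_def half_fibre_def)
    also have "\<dots> \<le> (if \<beta> (snd y) \<noteq> \<alpha> (fst y) then c y else 0)" by simp
    finally show "part c S y + (\<Sum>g\<in>pverts A. part c (half_fibre g (\<not> \<alpha> g)) y) \<le> c y"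
      by (auto simp: part_def S_def half_fibre_def split: if_splits)
  qed
  ultimately have 1: "yields K c c'" by (rule yields_mono) simp
  have "?E c' = ?E (part c S) + (\<Sum>g\<in>pverts A. \<Sum>k\<in>pverts A.
      sum (pile (w k div (2 * ?q)) (x k, h2)) (half_fibre g (\<alpha> g)))"
    unfolding c'_def by (simp add: sum.distrib sum.swap[of _ "pverts A" "half_fibre _ _"])
  also have "?E (part c S) = ?E c"
    by (intro sum.cong) (auto simp: part_def S_def)
  also have "(\<Sum>g\<in>pverts A. \<Sum>k\<in>pverts A.
      sum (pile (w k div (2 * ?q)) (x k, h2)) (half_fibre g (\<alpha> g)))
      = (\<Sum>k\<in>pverts A. \<Sum>g\<in>pverts A. if g = x k then w k div (2 * ?q) else 0)"
    using x h2 by (subst sum.swap, intro sum.cong refl)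
      (auto simp: pile_def finite_half_fibre, auto simp: half_fibre_def)
  also have "\<dots> = (\<Sum>k\<in>pverts A. w k div (2 * ?q))"
    using x by (intro sum.cong) auto
  finally have E: "?E c' = ?E c + (\<Sum>k\<in>pverts A. w k div (2 * ?q))" .
  have total: "(\<Sum>v\<in>pverts A \<times> pverts B. c v) = ?E c + (\<Sum>g\<in>pverts A. w g)"
  proof -
    have "(\<Sum>h\<in>pverts B. c (g, h))
        = sum c (half_fibre g (\<alpha> g)) + sum c (half_fibre g (\<not> \<alpha> g))" for g
    proof -
      have "(\<Sum>h\<in>pverts B. c (g, h)) = sum c ({g} \<times> pverts B)"
        by (rule sum_fibre[symmetric])
      also have "{g} \<times> pverts B = half_fibre g (\<alpha> g) \<union> half_fibre g (\<not> \<alpha> g)"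
        by (auto simp: half_fibre_def)
      also have "sum c \<dots> = sum c (half_fibre g (\<alpha> g)) + sum c (half_fibre g (\<not> \<alpha> g))"
        by (intro sum.union_disjoint finite_half_fibre) (auto simp: half_fibre_def)
      finally show ?thesis .
    qed
    moreover have "(\<Sum>v\<in>pverts A \<times> pverts B. c v) = (\<Sum>g\<in>pverts A. \<Sum>h\<in>pverts B. c (g, h))"
      by (simp add: sum.cartesian_product)
    ultimately show ?thesis by (simp add: w_def sum.distrib)
  qed
  have "?p * ?q + ?n * (?q - 1) \<le> ?E c'"
  proof -
    define s where "s = (\<Sum>k\<in>pverts A. w k div (2 * ?q))"
    have "w g \<le> 2 * ?q * (w g div (2 * ?q)) + 2 * ?q" for g
      using mult_div_mod_eq[of "2 * ?q" "w g"] mod_less_divisor[of "2 * ?q" "w g"] q by linarith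
    then have "(\<Sum>g\<in>pverts A. w g) \<le> (\<Sum>g\<in>pverts A. 2 * ?q * (w g div (2 * ?q)) + 2 * ?q)"
      by (intro sum_mono)
    also have "\<dots> = 2 * ?q * s + ?n * (2 * ?q)"
      by (simp add: sum.distrib sum_distrib_left s_def)
    finally have "2 * (?p + ?n) * ?q\<^sup>2 \<le> ?E c + (2 * ?q * s + ?n * (2 * ?q))"
      using size total by linarith
    also have "\<dots> \<le> 2 * ?q * ?E c + (2 * ?q * s + ?n * (2 * ?q))" using q by simp
    also have "\<dots> = 2 * ?q * (?E c' + ?n)" unfolding E s_def by (simp add: algebra_simps)
    finally have "2 * ?q * ((?p + ?n) * ?q) \<le> 2 * ?q * (?E c' + ?n)"
      by (simp add: power2_eq_square mult_ac)
    then have "(?p + ?n) * ?q \<le> ?E c' + ?n" using q by simp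
    moreover have "?n * (?q - 1) = ?n * ?q - ?n" by (simp add: diff_mult_distrib2)
    moreover have "?n \<le> ?n * ?q" using q by simp
    ultimately show ?thesis unfolding add_mult_distrib by linarith
  qed
  then have "yields K c' (pile 1 (r, h))" 
    using nb by (intro solve_even_component[OF _ hh' r rh])
  with 1 show ?thesis by (rule yields_trans)
qed

end

section \<open>The bound for the cross product\<close>

lemma bipartite_colouring:
  assumes "bipartite F"
  shows "\<exists>\<alpha> :: _ \<Rightarrow> bool. \<forall>x y. (x, y) \<in> parcs F \<longrightarrow> \<alpha> x \<noteq> \<alpha> y"
proof -
  obtain A B where "A \<inter> B = {}" "parcs F \<subseteq> A \<times> B \<union> B \<times> A"
    using assms by (auto simp: bipartite_def)
  then show ?thesis by (intro exI[of _ "\<lambda>x. x \<in> A"]) (auto simp: disjoint_iff)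
qed

lemma not_bipartite_monochromatic_arc:
  assumes "pair_graph F" and "\<not> bipartite F"
  shows "\<exists>x y. (x, y) \<in> parcs F \<and> (\<beta> x :: bool) = \<beta> y"
proof (rule ccontr)
  interpret pair_graph F by fact
  assume "\<not> ?thesis"
  then have "bipartite F" unfolding bipartite_def
    by (intro exI[of _ "{x \<in> pverts F. \<beta> x}"] exI[of _ "{x \<in> pverts F. \<not> \<beta> x}"])
      (auto dest: wellformed')
  with assms(2) show False by contradiction
qed

lemma connected_has_neighbour:
  assumes "pair_graph F" and "Digraph_Component.connected (with_proj F)"
    and "card (pverts F) \<noteq> 1" and "x \<in> pverts F"
  shows "\<exists>y. (x, y) \<in> parcs F"
proof -
  have "pverts F \<noteq> {x}" using assms(3) by auto
  then obtain z where "z \<in> pverts F" "z \<noteq> x" using assms(4) by blast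
  then show ?thesis
    using connected_imp_rtrancl[OF assms(1,2,4), of z] by (auto elim: converse_rtranclE)
qed

theorem theorem5p1:
  fixes G G' :: "'a pair_pre_digraph" and H H' :: "'b pair_pre_digraph"
  assumes "pair_graph G" and "Digraph_Component.connected (with_proj G)"
    and "card (pverts G) \<noteq> 1"
    and "pair_graph H" and "Digraph_Component.connected (with_proj H)"
    and "\<not> bipartite H"
    and "pair_graph G'" and "Digraph_Component.connected (with_proj G')"
    and "spanning (with_proj G') (with_proj G)" and "bipartite G'"
    and "pair_graph H'" and "Digraph_Component.connected (with_proj H')"
    and "spanning (with_proj H') (with_proj H)" and "bipartite H'"
  shows "pebbling_number (cross_product G H)
           \<le> 2 * (pebbling_number G' + card (pverts G)) * (pebbling_number H')\<^sup>2"
proof -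
  interpret H: pair_graph H by fact
  let ?K = "cross_product G H"
  have VG: "pverts G' = pverts G" and EG: "parcs G' \<subseteq> parcs G"
    using assms(9) by (auto simp: spanning_def subgraph_def)
  have VH: "pverts H' = pverts H" and EH: "parcs H' \<subseteq> parcs H"
    using assms(13) by (auto simp: spanning_def subgraph_def)
  obtain \<alpha> :: "'a \<Rightarrow> bool" where \<alpha>: "\<And>x y. (x, y) \<in> parcs G' \<Longrightarrow> \<alpha> x \<noteq> \<alpha> y"
    using bipartite_colouring[OF assms(10)] by blast
  obtain \<beta>\<^sub>0 :: "'b \<Rightarrow> bool" where \<beta>\<^sub>0: "\<And>x y. (x, y) \<in> parcs H' \<Longrightarrow> \<beta>\<^sub>0 x \<noteq> \<beta>\<^sub>0 y"
    using bipartite_colouring[OF assms(14)] by blast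
  have nbG: "\<exists>y. (x, y) \<in> parcs G'" if "x \<in> pverts G'" for x
    using connected_has_neighbour[OF assms(7,8) _ that] assms(3) VG by simp
  obtain h1 h2 where h12: "(h1, h2) \<in> parcs H" "\<beta>\<^sub>0 h1 = \<beta>\<^sub>0 h2"
    using not_bipartite_monochromatic_arc[OF assms(4,6)] by blast
  have h12V: "h1 \<in> pverts H'" "h2 \<in> pverts H'" and "h1 \<noteq> h2"
    using h12(1) H.no_loops' by (auto simp: VH dest: H.wellformed')
  then have "card (pverts H') \<noteq> 1" by (auto simp: card_1_singleton_iff)
  then have nbH: "\<exists>y. (x, y) \<in> parcs H'" if "x \<in> pverts H'" for x
    using connected_has_neighbour[OF assms(11,12) _ that] by simp
  have "solvable ?K (r, h) c"
    if rh: "(r, h) \<in> pverts ?K"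
      and c: "config_size ?K c
        = 2 * (pebbling_number G' + card (pverts G)) * (pebbling_number H')\<^sup>2"
    for r h c
  proof -
    have r: "r \<in> pverts G'" and h: "h \<in> pverts H'"
      using rh by (auto simp: cross_product_def VG VH)
    obtain h' where hh': "(h, h') \<in> parcs H'" using nbH[OF h] by blast
    \<comment> \<open>Swap the two colours of \<open>H'\<close> if needed, so that the root becomes even.\<close>
    define \<beta> where "\<beta> x = (\<beta>\<^sub>0 x = (\<beta>\<^sub>0 h = \<alpha> r))" for x
    interpret bicoloured_factors G' H' ?K \<alpha> \<beta>
      by (rule bicoloured_factors.intro)
        (use assms(7,8,11,12) \<alpha> \<beta>\<^sub>0 EG EH in \<open>auto simp: cross_product_def \<beta>_def\<close>)
    have "yields ?K c (pile 1 (r, h))"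
    proof (rule solve_with_odd_edge[OF nbG hh' r _ h12V])
      show "((x, h1), (x', h2)) \<in> parcs ?K" if "(x, x') \<in> parcs G'" for x x'
        using that h12(1) EG by (auto simp: cross_product_def)
    qed (use c h12(2) in \<open>auto simp: \<beta>_def config_size_def cross_product_def VG VH\<close>)
    then show ?thesis by (simp add: solvable_iff_yields)
  qed
  then show ?thesis unfolding pebbling_number_def[of ?K] by (intro Least_le) auto
qed

end
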